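(* Let $(q,\boldsymbol{\mathcal F}_q,\boldsymbol{\mathcal G}_q,\boldsymbol c_q)$ be a secondary structure of a conservation law $\partial_t\boldsymbol u+\sum_{i=1}^d\partial_{x_i}\boldsymbol f^i(\boldsymbol u)=0$ with state space $\mathcal U\subseteq\mathbb R^n$, let $j\in\{1,\dots,d\}$, and let $W^j:\mathcal U\times\mathcal U\to\mathbb R$ be a numerical work term. For $\boldsymbol u,\boldsymbol v\in\mathcal U$ put $$\mathcal P_q^j(\boldsymbol u,\boldsymbol v):=\{\boldsymbol w\in\mathbb R^n:\ \Delta\psi_q^j(\boldsymbol u,\boldsymbol v)-\boldsymbol w^T\Delta\boldsymbol\xi(\boldsymbol u,\boldsymbol v)=W^j(\boldsymbol u,\boldsymbol v)\}.$$ (i) (Necessity.) If there exists a numerical flux function $\boldsymbol f_h^j:\mathcal U\times\mathcal U\to\mathbb R^n$ with $\Delta\psi_q^j(\boldsymbol u,\boldsymbol v)-\boldsymbol f_h^j(\boldsymbol u,\boldsymbol v)^T\Delta\boldsymbol\xi(\boldsymbol u,\boldsymbol v)=W^j(\boldsymbol u,\boldsymbol v)$ for all $\boldsymbol u,\boldsymbol v\in\mathcal U$, then $W^j$ satisfies weak discrete null-consistency: for all $\boldsymbol u,\boldsymbol v\in\mathcal U$, $$\Delta\boldsymbol\xi(\boldsymbol u,\boldsymbol v)=0\ \Longrightarrow\ \Delta\psi_q^j(\boldsymbol u,\boldsymbol v)=W^j(\boldsymbol u,\boldsymbol v).$$ (ii) If $W^j$ satisfies weak discrete null-consistency, then $\mathcal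 P_q^j(\boldsymbol u,\boldsymbol v)\neq\emptyset$ for all $\boldsymbol u,\boldsymbol v\in\mathcal U$; more precisely $\mathcal P_q^j(\boldsymbol u,\boldsymbol v)=\mathbb R^n$ when $\Delta\boldsymbol\xi(\boldsymbol u,\boldsymbol v)=0$, and $\mathcal P_q^j(\boldsymbol u,\boldsymbol v)$ is an (affine) hyperplane otherwise.
   Context: Setting: $\mathcal U\subseteq\mathbb R^n$ is open and $\boldsymbol f^i:\mathcal U\to\mathbb R^n$, $i=1,\dots,d$, are $C^1$ flux functions. A secondary structure is a tuple with $q:\mathcal U\to\mathbb R$ of class $C^2$ (not necessarily convex), $\mathcal F_q^i,\mathcal G_q^i:\mathcal U\to\mathbb R$ of class $C^1$ and $c_q^i:\mathcal U\to\mathbb R$ such that, with $\boldsymbol\xi(\boldsymbol u):=\frac{\partial q}{\partial\boldsymbol u}(\boldsymbol u)$, $$\boldsymbol\xi(\boldsymbol u)^T\frac{\partial\boldsymbol f^i}{\partial\boldsymbol u}=\Big(\frac{\partial\mathcal F_q^i}{\partial\boldsymbol u}\Big)^T+c_q^i(\boldsymbol u)\Big(\frac{\partial\mathcal G_q^i}{\partial\boldsymbol u}\Big)^T,\qquad i=1,\dots,d .$$ The residual function is $\psi_q^i(\boldsymbol u):=\boldsymbol\xi(\boldsymbol u)^T\boldsymbol f^i(\boldsymbol u)-\mathcal F_q^i(\boldsymbol u)$, and $\Delta g(\boldsymbol u,\boldsymbol v):=g(\boldsymbol v)-g(\boldsymbol u)$. A numerical work term $W^j$ (written $[c_q^j\Delta\mathcal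 G_q^j]$ in the source) is an anti-symmetric function, $W^j(\boldsymbol u,\boldsymbol v)=-W^j(\boldsymbol v,\boldsymbol u)$, which divided by the cell width consistently approximates $c_q^j\,\partial_{x_j}\mathcal G_q^j$: for every $C^1$ curve $x\mapsto\boldsymbol u(x)\in\mathcal U$, $W^j(\boldsymbol u(x),\boldsymbol u(x+h))/h\to c_q^j(\boldsymbol u(x))\frac{d}{dx}\mathcal G_q^j(\boldsymbol u(x))$ as $h\to0^+$. A numerical flux function is symmetric, $\boldsymbol f_h^j(\boldsymbol u,\boldsymbol v)=\boldsymbol f_h^j(\boldsymbol v,\boldsymbol u)$, and consistent, $\boldsymbol f_h^j(\boldsymbol u,\boldsymbol u)=\boldsymbol f^j(\boldsymbol u)$. *)

theory Defs
  imports "HOL-Analysis.Analysis"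
begin

text \<open>The derivative is required at every point with respect to the full neighbourhood filter, so
  this is meant for open \<open>U\<close>.\<close>

definition C1_on :: "('a::real_normed_vector) set \<Rightarrow> ('a \<Rightarrow> 'b::real_normed_vector) \<Rightarrow> bool" where
  "C1_on U g \<longleftrightarrow>
     (\<exists>g' :: 'a \<Rightarrow> 'a \<Rightarrow>\<^sub>L 'b.
        (\<forall>u\<in>U. (g has_derivative blinfun_apply (g' u)) (at u)) \<and> continuous_on U g')"

definition gradient :: "(real^'n \<Rightarrow> real) \<Rightarrow> real^'n \<Rightarrow> real^'n" where
  "gradient g u = (\<chi> k. frechet_derivative g (at u) (axis k 1))"

lemma GDERIV_gradient:
  assumes "g differentiable (at u)"
  shows "GDERIV g u :> gradient g u"
proof -
  let ?D = "frechet_derivative g (at u)"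
  have D: "(g has_derivative ?D) (at u)"
    using assms by (simp add: frechet_derivative_works)
  then interpret linear ?D
    by (rule has_derivative_linear)
  have "?D h = h \<bullet> gradient g u" for h
  proof -
    have "?D h = ?D (\<Sum>k\<in>UNIV. (h $ k) *\<^sub>R axis k 1)"
      by (metis basis_expansion scalar_mult_eq_scaleR)
    also have "\<dots> = h \<bullet> gradient g u"
      by (simp add: sum scale gradient_def inner_vec_def)
    finally show ?thesis .
  qed
  then have "?D = (\<lambda>h. h \<bullet> gradient g u)"
    by (rule ext)
  with D show ?thesis
    by (simp add: gderiv_def)
qed

definition C2_on :: "(real^'n) set \<Rightarrow> (real^'n \<Rightarrow> real) \<Rightarrow> bool" where
  "C2_on U g \<longleftrightarrow> C1_on U g \<and> C1_on U (gradient g)"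

text \<open>A system \<open>\<partial>\<^sub>t u + (\<Sum>i=1..d. \<partial>\<^sub>x\<^sub>i (f i u)) = 0\<close> is given by its state space and its fluxes;
  only the values \<open>f i u\<close> with \<open>i \<in> {1..d}\<close> and \<open>u \<in> U\<close> are meaningful.\<close>

definition conservation_law ::
  "(real^'n) set \<Rightarrow> nat \<Rightarrow> (nat \<Rightarrow> real^'n \<Rightarrow> real^'n) \<Rightarrow> bool" where
  "conservation_law U d f \<longleftrightarrow> open U \<and> (\<forall>i\<in>{1..d}. C1_on U (f i))"

definition secondary_structure ::
  "(real^'n) set \<Rightarrow> nat \<Rightarrow> (nat \<Rightarrow> real^'n \<Rightarrow> real^'n) \<Rightarrow> (real^'n \<Rightarrow> real)
    \<Rightarrow> (nat \<Rightarrow> real^'n \<Rightarrow> real) \<Rightarrow> (nat \<Rightarrow> real^'n \<Rightarrow> real) \<Rightarrow> (nat \<Rightarrow> real^'n \<Rightarrow> real) \<Rightarrow> bool" where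
  "secondary_structure U d f q F G c \<longleftrightarrow>
     C2_on U q \<and>
     (\<forall>i\<in>{1..d}. C1_on U (F i) \<and> C1_on U (G i) \<and>
        (\<forall>u\<in>U. gradient q u v* jacobian (f i) (at u)
                = gradient (F i) u + c i u *\<^sub>R gradient (G i) u))"

definition residual ::
  "(real^'n \<Rightarrow> real) \<Rightarrow> (real^'n \<Rightarrow> real^'n) \<Rightarrow> (real^'n \<Rightarrow> real) \<Rightarrow> real^'n \<Rightarrow> real" where
  "residual q f F u = gradient q u \<bullet> f u - F u"

definition Delta :: "('a \<Rightarrow> 'b::ab_group_add) \<Rightarrow> 'a \<Rightarrow> 'a \<Rightarrow> 'b" where
  "Delta g u v = g v - g u"

definition numerical_work_term ::
  "(real^'n) set \<Rightarrow> (real^'n \<Rightarrow> real) \<Rightarrow> (real^'n \<Rightarrow> real) \<Rightarrow> (real^'n \<Rightarrow> real^'n \<Rightarrow> real) \<Rightarrow> bool" where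
  "numerical_work_term U c G W \<longleftrightarrow>
     (\<forall>u\<in>U. \<forall>v\<in>U. W u v = - W v u) \<and>
     (\<forall>(\<gamma> :: real \<Rightarrow> real^'n) a b.
        \<gamma> C1_differentiable_on {a<..<b} \<longrightarrow> \<gamma> ` {a<..<b} \<subseteq> U \<longrightarrow>
        (\<forall>x\<in>{a<..<b}.
           ((\<lambda>h. W (\<gamma> x) (\<gamma> (x + h)) / h) \<longlongrightarrow> c (\<gamma> x) * deriv (\<lambda>s. G (\<gamma> s)) x)
             (at_right 0)))"

definition numerical_flux ::
  "(real^'n) set \<Rightarrow> (real^'n \<Rightarrow> real^'n) \<Rightarrow> (real^'n \<Rightarrow> real^'n \<Rightarrow> real^'n) \<Rightarrow> bool" where
  "numerical_flux U f fh \<longleftrightarrow>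
     (\<forall>u\<in>U. \<forall>v\<in>U. fh u v = fh v u) \<and> (\<forall>u\<in>U. fh u u = f u)"

text \<open>In the following definitions \<open>\<xi>\<close> stands for \<open>gradient q\<close> and \<open>\<psi>\<close> for the residual function.\<close>

definition flux_set ::
  "(real^'n \<Rightarrow> real^'n) \<Rightarrow> (real^'n \<Rightarrow> real) \<Rightarrow> (real^'n \<Rightarrow> real^'n \<Rightarrow> real)
    \<Rightarrow> real^'n \<Rightarrow> real^'n \<Rightarrow> (real^'n) set" where
  "flux_set \<xi> \<psi> W u v = {w. Delta \<psi> u v - w \<bullet> Delta \<xi> u v = W u v}"

definition weak_discrete_null_consistency ::
  "(real^'n) set \<Rightarrow> (real^'n \<Rightarrow> real^'n) \<Rightarrow> (real^'n \<Rightarrow> real) \<Rightarrow> (real^'n \<Rightarrow> real^'n \<Rightarrow> real) \<Rightarrow> bool" where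
  "weak_discrete_null_consistency U \<xi> \<psi> W \<longleftrightarrow>
     (\<forall>u\<in>U. \<forall>v\<in>U. Delta \<xi> u v = 0 \<longrightarrow> Delta \<psi> u v = W u v)"

definition affine_hyperplane_set :: "(real^'n) set \<Rightarrow> bool" where
  "affine_hyperplane_set S \<longleftrightarrow> affine S \<and> aff_dim S = int CARD('n) - 1"

end

theory Submission
  imports Defs
begin

text \<open>
  For fixed states, \<open>w\<close> lies in the flux set iff it solves the single linear equation
  \<open>\<Delta>\<xi> \<bullet> w = \<Delta>\<psi> - W\<close>.  If the normal \<open>\<Delta>\<xi>\<close> is nonzero, this is the equation of a hyperplane.
  If it vanishes, the equation no longer involves \<open>w\<close>, and is solvable iff \<open>\<Delta>\<psi> = W\<close>, in which
  case every \<open>w\<close> solves it.  Weak discrete null-consistency is therefore exactly the solvability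
  of this equation for every pair of states: a numerical flux provides one solution per pair,
  which gives necessity, and the shape of the solution set gives the converse.
\<close>

lemma flux_set_eq_hyperplane:
  "flux_set \<xi> \<psi> W u v = {w. Delta \<xi> u v \<bullet> w = Delta \<psi> u v - W u v}"
  by (auto simp: flux_set_def inner_commute algebra_simps)

lemma weak_discrete_null_consistency_iff_flux_set_nonempty:
  "weak_discrete_null_consistency U \<xi> \<psi> W \<longleftrightarrow> (\<forall>u\<in>U. \<forall>v\<in>U. flux_set \<xi> \<psi> W u v \<noteq> {})"
proof -
  have "flux_set \<xi> \<psi> W u v = {} \<longleftrightarrow> Delta \<xi> u v = 0 \<and> Delta \<psi> u v \<noteq> W u v" for u v
    unfolding flux_set_eq_hyperplane hyperplane_eq_empty by simp
  then show ?thesis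
    by (auto simp: weak_discrete_null_consistency_def)
qed

lemma flux_set_eq_UNIV:
  assumes "weak_discrete_null_consistency U \<xi> \<psi> W" "u \<in> U" "v \<in> U" "Delta \<xi> u v = 0"
  shows "flux_set \<xi> \<psi> W u v = UNIV"
  using assms by (simp add: weak_discrete_null_consistency_def flux_set_eq_hyperplane)

lemma affine_hyperplane_flux_set:
  assumes "Delta \<xi> u v \<noteq> 0"
  shows "affine_hyperplane_set (flux_set \<xi> \<psi> W u v)"
  using assms
  by (simp add: affine_hyperplane_set_def flux_set_eq_hyperplane affine_hyperplane aff_dim_hyperplane)

theorem mainTheorem2:
  fixes U :: "(real^'n) set"
    and d j :: nat
    and f :: "nat \<Rightarrow> real^'n \<Rightarrow> real^'n"
    and q :: "real^'n \<Rightarrow> real"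
    and F G c :: "nat \<Rightarrow> real^'n \<Rightarrow> real"
    and W :: "real^'n \<Rightarrow> real^'n \<Rightarrow> real"
  assumes "conservation_law U d f"
    and "secondary_structure U d f q F G c"
    and "j \<in> {1..d}"
    and "numerical_work_term U (c j) (G j) W"
  shows "((\<exists>fh. numerical_flux U (f j) fh \<and>
             (\<forall>u\<in>U. \<forall>v\<in>U. Delta (residual q (f j) (F j)) u v
                              - fh u v \<bullet> Delta (gradient q) u v = W u v))
           \<longrightarrow> weak_discrete_null_consistency U (gradient q) (residual q (f j) (F j)) W)
    \<and> (weak_discrete_null_consistency U (gradient q) (residual q (f j) (F j)) W
        \<longrightarrow> (\<forall>u\<in>U. \<forall>v\<in>U.
              flux_set (gradient q) (residual q (f j) (F j)) W u v \<noteq> {} \<and>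
              (Delta (gradient q) u v = 0 \<longrightarrow>
                 flux_set (gradient q) (residual q (f j) (F j)) W u v = UNIV) \<and>
              (Delta (gradient q) u v \<noteq> 0 \<longrightarrow>
                 affine_hyperplane_set (flux_set (gradient q) (residual q (f j) (F j)) W u v))))"
proof (intro conjI impI ballI)
  let ?\<xi> = "gradient q" and ?\<psi> = "residual q (f j) (F j)"
  {
    assume "\<exists>fh. numerical_flux U (f j) fh \<and>
      (\<forall>u\<in>U. \<forall>v\<in>U. Delta ?\<psi> u v - fh u v \<bullet> Delta ?\<xi> u v = W u v)"
    then have "\<forall>u\<in>U. \<forall>v\<in>U. flux_set ?\<xi> ?\<psi> W u v \<noteq> {}"
      unfolding flux_set_def by blast
    then show "weak_discrete_null_consistency U ?\<xi> ?\<psi> W"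
      by (simp add: weak_discrete_null_consistency_iff_flux_set_nonempty)
  }
  fix u v
  assume null: "weak_discrete_null_consistency U ?\<xi> ?\<psi> W" and "u \<in> U" "v \<in> U"
  then show "flux_set ?\<xi> ?\<psi> W u v \<noteq> {}"
    by (simp add: weak_discrete_null_consistency_iff_flux_set_nonempty)
  show "flux_set ?\<xi> ?\<psi> W u v = UNIV" if "Delta ?\<xi> u v = 0"
    using null \<open>u \<in> U\<close> \<open>v \<in> U\<close> that by (rule flux_set_eq_UNIV)
  show "affine_hyperplane_set (flux_set ?\<xi> ?\<psi> W u v)" if "Delta ?\<xi> u v \<noteq> 0"
    using that by (rule affine_hyperplane_flux_set)
qed

end
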